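(* For the downlink pinching-antenna system with a single pinching antenna, $$\mathcal R_{\mathrm S,\mathrm T}^{\mathrm D}\subseteq\mathcal R_{\mathrm S,\mathrm F}^{\mathrm D}\subseteq\mathcal C_{\mathrm S}^{\mathrm D}.$$
   Context: Let $\eta,\sigma^2,d_1,d_2,P>0$ and $x_1\le x_2$ with $[x_1,x_2]\subseteq[q_0,q_{\max}]$. For $q\in\mathbb R$ put $|h_k(q)|^2=\frac{\eta}{d_k^2+(x_k-q)^2}$, $k=1,2$. $\mathrm{Conv}$ denotes the convex hull. For each pair of uplink powers $P_1,P_2\ge0$ define the (dual) uplink regions as follows. Uplink capacity region: $\mathcal C_{\mathrm S}^{\mathrm U}=\mathrm{Conv}(\bigcup_{q\in[q_0,q_{\max}]}\mathcal C^{\mathrm U}(q))$, where $\mathcal C^{\mathrm U}(q)$ is the set of $(R_1,R_2)$ with $0\le R_k\le\log_2(1+P_k|h_k(q)|^2/\sigma^2)$, $k=1,2$, and $R_1+R_2\le\log_2(1+(P_1|h_1(q)|^2+P_2|h_2(q)|^2)/\sigma^2)$. Uplink TDMA region: $\mathcal R_{\mathrm S,\mathrm T}^{\mathrm U}=\bigcup_{\rho\in[0,1]}\{(R_1,R_2):0\le R_1\le\rho\log_2(1+\frac{P_1\eta}{d_1^2\sigma^2}),\ 0\le R_2\le(1-\rho)\log_2(1+\frac{P_2\eta}{d_2^2\sigma^2})\}$. Uplink FDMA region: $\mathcal R_{\mathrm S,\mathrm F}^{\mathrm U}=\mathrm{Conv}(\bigcup_{q\in[x_1,x_2]}\bigcup_{\rho\in[0,1]}\{(R_1,R_2):0\le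 R_k\le r_k^\rho(q),\ k=1,2\})$ with $r_1^\rho(q)=\rho\log_2(1+\frac{P_1|h_1(q)|^2}{\rho\sigma^2})$, $r_2^\rho(q)=(1-\rho)\log_2(1+\frac{P_2|h_2(q)|^2}{(1-\rho)\sigma^2})$, $r_1^0\equiv0$, $r_2^1\equiv0$. The downlink regions with total power $P$ are, via uplink-downlink duality, $\mathcal C_{\mathrm S}^{\mathrm D}=\mathrm{Conv}(\bigcup_{P_1+P_2=P}\mathcal C_{\mathrm S}^{\mathrm U})$, $\mathcal R_{\mathrm S,\mathrm T}^{\mathrm D}=\mathrm{Conv}(\bigcup_{P_1+P_2=P}\mathcal R_{\mathrm S,\mathrm T}^{\mathrm U})$, $\mathcal R_{\mathrm S,\mathrm F}^{\mathrm D}=\mathrm{Conv}(\bigcup_{P_1+P_2=P}\mathcal R_{\mathrm S,\mathrm F}^{\mathrm U})$, where the unions are over all $P_1,P_2\ge0$ with $P_1+P_2=P$. *)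

theory Defs
  imports "HOL-Analysis.Analysis"
begin

text \<open>Squared channel gain \<open>|h(q)|\<^sup>2\<close> between the pinching antenna at position \<open>q\<close> and a user
  with coordinate \<open>x\<close> along the waveguide and distance \<open>d\<close> from it.\<close>

definition gain :: "real \<Rightarrow> real \<Rightarrow> real \<Rightarrow> real \<Rightarrow> real" where
  "gain \<eta> d x q = \<eta> / (d\<^sup>2 + (x - q)\<^sup>2)"

definition uplink_capacity_at ::
    "real \<Rightarrow> real \<Rightarrow> real \<Rightarrow> real \<Rightarrow> real \<Rightarrow> real \<Rightarrow> real \<Rightarrow> real \<Rightarrow> real \<Rightarrow> (real \<times> real) set" where
  "uplink_capacity_at \<eta> \<sigma> d1 d2 x1 x2 P1 P2 q =
     {(R1, R2).
        0 \<le> R1 \<and> R1 \<le> log 2 (1 + P1 * gain \<eta> d1 x1 q / \<sigma>\<^sup>2) \<and>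
        0 \<le> R2 \<and> R2 \<le> log 2 (1 + P2 * gain \<eta> d2 x2 q / \<sigma>\<^sup>2) \<and>
        R1 + R2 \<le> log 2 (1 + (P1 * gain \<eta> d1 x1 q + P2 * gain \<eta> d2 x2 q) / \<sigma>\<^sup>2)}"

definition uplink_capacity ::
    "real \<Rightarrow> real \<Rightarrow> real \<Rightarrow> real \<Rightarrow> real \<Rightarrow> real \<Rightarrow> real \<Rightarrow> real \<Rightarrow> real \<Rightarrow> real \<Rightarrow> (real \<times> real) set" where
  "uplink_capacity \<eta> \<sigma> d1 d2 x1 x2 q0 qmax P1 P2 =
     convex hull (\<Union>q\<in>{q0..qmax}. uplink_capacity_at \<eta> \<sigma> d1 d2 x1 x2 P1 P2 q)"

definition uplink_TDMA ::
    "real \<Rightarrow> real \<Rightarrow> real \<Rightarrow> real \<Rightarrow> real \<Rightarrow> real \<Rightarrow> (real \<times> real) set" where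
  "uplink_TDMA \<eta> \<sigma> d1 d2 P1 P2 =
     (\<Union>\<rho>\<in>{0..1}. {(R1, R2).
        0 \<le> R1 \<and> R1 \<le> \<rho> * log 2 (1 + P1 * \<eta> / (d1\<^sup>2 * \<sigma>\<^sup>2)) \<and>
        0 \<le> R2 \<and> R2 \<le> (1 - \<rho>) * log 2 (1 + P2 * \<eta> / (d2\<^sup>2 * \<sigma>\<^sup>2))})"

text \<open>FDMA rate of a user with bandwidth fraction \<open>w\<close>, power \<open>p\<close> and squared gain \<open>g\<close>; thus
  \<open>r\<^sub>1\<close> is the case \<open>w = \<rho>\<close> and \<open>r\<^sub>2\<close> the case \<open>w = 1 - \<rho>\<close>.\<close>

definition FDMA_rate :: "real \<Rightarrow> real \<Rightarrow> real \<Rightarrow> real \<Rightarrow> real" where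
  "FDMA_rate \<sigma> w p g = (if w = 0 then 0 else w * log 2 (1 + p * g / (w * \<sigma>\<^sup>2)))"

definition uplink_FDMA ::
    "real \<Rightarrow> real \<Rightarrow> real \<Rightarrow> real \<Rightarrow> real \<Rightarrow> real \<Rightarrow> real \<Rightarrow> real \<Rightarrow> (real \<times> real) set" where
  "uplink_FDMA \<eta> \<sigma> d1 d2 x1 x2 P1 P2 =
     convex hull (\<Union>q\<in>{x1..x2}. \<Union>\<rho>\<in>{0..1}. {(R1, R2).
        0 \<le> R1 \<and> R1 \<le> FDMA_rate \<sigma> \<rho> P1 (gain \<eta> d1 x1 q) \<and>
        0 \<le> R2 \<and> R2 \<le> FDMA_rate \<sigma> (1 - \<rho>) P2 (gain \<eta> d2 x2 q)})"

text \<open>Downlink region with total power \<open>P\<close> obtained by uplink-downlink duality from a family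
  of dual uplink regions indexed by the two uplink powers.\<close>

definition downlink :: "real \<Rightarrow> (real \<Rightarrow> real \<Rightarrow> (real \<times> real) set) \<Rightarrow> (real \<times> real) set" where
  "downlink P U = convex hull (\<Union>(P1, P2)\<in>{(P1, P2). 0 \<le> P1 \<and> 0 \<le> P2 \<and> P1 + P2 = P}. U P1 P2)"

definition downlink_capacity ::
    "real \<Rightarrow> real \<Rightarrow> real \<Rightarrow> real \<Rightarrow> real \<Rightarrow> real \<Rightarrow> real \<Rightarrow> real \<Rightarrow> real \<Rightarrow> (real \<times> real) set" where
  "downlink_capacity \<eta> \<sigma> d1 d2 x1 x2 q0 qmax P =
     downlink P (uplink_capacity \<eta> \<sigma> d1 d2 x1 x2 q0 qmax)"

definition downlink_TDMA ::
    "real \<Rightarrow> real \<Rightarrow> real \<Rightarrow> real \<Rightarrow> real \<Rightarrow> (real \<times> real) set" where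
  "downlink_TDMA \<eta> \<sigma> d1 d2 P = downlink P (uplink_TDMA \<eta> \<sigma> d1 d2)"

definition downlink_FDMA ::
    "real \<Rightarrow> real \<Rightarrow> real \<Rightarrow> real \<Rightarrow> real \<Rightarrow> real \<Rightarrow> real \<Rightarrow> (real \<times> real) set" where
  "downlink_FDMA \<eta> \<sigma> d1 d2 x1 x2 P = downlink P (uplink_FDMA \<eta> \<sigma> d1 d2 x1 x2)"

end

(* TDMA inside FDMA: the point (R1, R2) with time share rho is the convex combination, with weight
   rho, of (R1 / rho, 0) and (0, R2 / (1 - rho)); these are FDMA points with the whole bandwidth
   given to one user and the antenna placed at that user's coordinate.
   FDMA inside capacity: concavity of the logarithm, pointwise in the antenna position.
   Both inclusions already hold for every fixed pair of uplink powers. *)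

theory Submission
  imports Defs
begin

lemma downlink_mono:
  assumes "\<And>P1 P2. 0 \<le> P1 \<Longrightarrow> 0 \<le> P2 \<Longrightarrow> U P1 P2 \<subseteq> V P1 P2"
  shows "downlink P U \<subseteq> downlink P V"
  unfolding downlink_def using assms by (intro hull_mono) blast

lemma gain_nonneg: "0 \<le> \<eta> \<Longrightarrow> 0 \<le> gain \<eta> d x q"
  by (simp add: gain_def)

text \<open>Uniform in \<open>w\<close>, since division by zero yields \<open>0\<close>.\<close>

lemma FDMA_rate_eq: "FDMA_rate \<sigma> w p g = w * log 2 (1 + (p * g / \<sigma>\<^sup>2) / w)"
  by (simp add: FDMA_rate_def divide_divide_eq_left mult.commute)

lemma FDMA_rate_nonneg:
  assumes "0 \<le> w" "0 \<le> p" "0 \<le> g"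
  shows "0 \<le> FDMA_rate \<sigma> w p g"
proof -
  have "0 \<le> p * g / \<sigma>\<^sup>2 / w"
    using assms by simp
  then show ?thesis
    unfolding FDMA_rate_eq using assms(1) by simp
qed

lemma log_concave_combination:
  fixes x y w b :: real
  assumes "1 < b" "0 < x" "0 < y" "0 \<le> w" "w \<le> 1"
  shows "w * log b x + (1 - w) * log b y \<le> log b (w * x + (1 - w) * y)"
proof -
  have "w * ln x + (1 - w) * ln y \<le> ln (w * x + (1 - w) * y)"
    using concave_onD[OF ln_concave, of w y x] assms by (simp add: add.commute)
  then show ?thesis
    using assms(1) by (simp add: log_def divide_right_mono flip: add_divide_distrib)
qed

text \<open>Jensen's inequality for the logarithm, with weights \<open>w\<close> and
  \<open>1 - w\<close> at the points \<open>1 + s / w\<close> and \<open>1 + t / (1 - w)\<close>: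
  the bandwidth fractions cancel in the average, which leaves at most
  \<open>1 + s + t\<close>.\<close>

lemma FDMA_sum_rate_le:
  assumes "0 \<le> w" "w \<le> 1" "0 \<le> p1" "0 \<le> p2" "0 \<le> g1" "0 \<le> g2"
  shows "FDMA_rate \<sigma> w p1 g1 + FDMA_rate \<sigma> (1 - w) p2 g2
           \<le> log 2 (1 + (p1 * g1 + p2 * g2) / \<sigma>\<^sup>2)"
proof -
  define s t where "s = p1 * g1 / \<sigma>\<^sup>2" and "t = p2 * g2 / \<sigma>\<^sup>2"
  have st: "0 \<le> s" "0 \<le> t"
    using assms by (simp_all add: s_def t_def)
  have pos: "0 \<le> s / w" "0 \<le> t / (1 - w)"
    using st assms by simp_all
  \<comment> \<open>Only inequalities: a user with bandwidth fraction zero gets 0 on the left,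
    whatever \<open>s\<close> or \<open>t\<close> is.\<close>
  have "w * (s / w) \<le> s" "(1 - w) * (t / (1 - w)) \<le> t"
    using st by simp_all
  then have le: "w * (1 + s / w) + (1 - w) * (1 + t / (1 - w)) \<le> 1 + (s + t)"
    unfolding distrib_left by simp
  have "0 \<le> w * (s / w)" "0 \<le> (1 - w) * (t / (1 - w))"
    using pos assms by (simp_all del: times_divide_eq_right)
  \<comment> \<open>The weights add up to 1, so the average is 1 plus two nonnegative terms.\<close>
  then have gt: "0 < w * (1 + s / w) + (1 - w) * (1 + t / (1 - w))"
    unfolding distrib_left mult_1_right by linarith
  have "w * log 2 (1 + s / w) + (1 - w) * log 2 (1 + t / (1 - w))
          \<le> log 2 (w * (1 + s / w) + (1 - w) * (1 + t / (1 - w)))"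
    using pos assms by (intro log_concave_combination) linarith+
  also have "\<dots> \<le> log 2 (1 + (s + t))"
    using le gt by (intro log_mono) simp_all
  finally show ?thesis
    by (simp add: FDMA_rate_eq s_def t_def add_divide_distrib)
qed

text \<open>The sum-rate bound with a silent second user: its power and gain are both 0.\<close>

lemma FDMA_rate_le:
  assumes "0 \<le> w" "w \<le> 1" "0 \<le> p" "0 \<le> g"
  shows "FDMA_rate \<sigma> w p g \<le> log 2 (1 + p * g / \<sigma>\<^sup>2)"
  using FDMA_sum_rate_le[OF assms(1,2,3) order_refl assms(4) order_refl, of \<sigma>]
  by (simp add: FDMA_rate_eq)

lemma uplink_FDMA_subset_capacity:
  assumes "0 \<le> \<eta>" "0 \<le> P1" "0 \<le> P2" "{x1..x2} \<subseteq> {q0..qmax}"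
  shows "uplink_FDMA \<eta> \<sigma> d1 d2 x1 x2 P1 P2 \<subseteq> uplink_capacity \<eta> \<sigma> d1 d2 x1 x2 q0 qmax P1 P2"
  unfolding uplink_FDMA_def uplink_capacity_def
\<comment> \<open>Each FDMA rectangle at \<open>q\<close> is compared with the capacity region at
  the same \<open>q\<close>; \<open>assms(4)\<close> accounts for the larger range of
  positions.\<close>
proof (intro hull_mono UN_mono assms(4) UN_least, clarify)
  fix q \<rho> R1 R2
  assume \<rho>: "\<rho> \<in> {0..1}"
    and R: "0 \<le> R1" "R1 \<le> FDMA_rate \<sigma> \<rho> P1 (gain \<eta> d1 x1 q)"
      "0 \<le> R2" "R2 \<le> FDMA_rate \<sigma> (1 - \<rho>) P2 (gain \<eta> d2 x2 q)"
  note g = gain_nonneg[OF assms(1)]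
  have "FDMA_rate \<sigma> \<rho> P1 (gain \<eta> d1 x1 q) \<le> log 2 (1 + P1 * gain \<eta> d1 x1 q / \<sigma>\<^sup>2)"
    "FDMA_rate \<sigma> (1 - \<rho>) P2 (gain \<eta> d2 x2 q) \<le> log 2 (1 + P2 * gain \<eta> d2 x2 q / \<sigma>\<^sup>2)"
    "FDMA_rate \<sigma> \<rho> P1 (gain \<eta> d1 x1 q) + FDMA_rate \<sigma> (1 - \<rho>) P2 (gain \<eta> d2 x2 q)
      \<le> log 2 (1 + (P1 * gain \<eta> d1 x1 q + P2 * gain \<eta> d2 x2 q) / \<sigma>\<^sup>2)"
    using \<rho> assms g by (intro FDMA_rate_le FDMA_sum_rate_le; simp)+
  with R show "(R1, R2) \<in> uplink_capacity_at \<eta> \<sigma> d1 d2 x1 x2 P1 P2 q"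
    unfolding uplink_capacity_at_def by simp
qed

lemma uplink_TDMA_subset_FDMA:
  assumes "0 \<le> \<eta>" "0 \<le> P1" "0 \<le> P2" "x1 \<le> x2"
  shows "uplink_TDMA \<eta> \<sigma> d1 d2 P1 P2 \<subseteq> uplink_FDMA \<eta> \<sigma> d1 d2 x1 x2 P1 P2"
proof (unfold uplink_TDMA_def, intro UN_least, clarify)
  fix \<rho> R1 R2 :: real
  define a where "a = log 2 (1 + P1 * \<eta> / (d1\<^sup>2 * \<sigma>\<^sup>2))"
  define b where "b = log 2 (1 + P2 * \<eta> / (d2\<^sup>2 * \<sigma>\<^sup>2))"
  assume \<rho>: "\<rho> \<in> {0..1}"
    and R: "0 \<le> R1" "R1 \<le> \<rho> * log 2 (1 + P1 * \<eta> / (d1\<^sup>2 * \<sigma>\<^sup>2))"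
      "0 \<le> R2" "R2 \<le> (1 - \<rho>) * log 2 (1 + P2 * \<eta> / (d2\<^sup>2 * \<sigma>\<^sup>2))"
  \<comment> \<open>With the antenna at the user's own coordinate, the horizontal offset vanishes
    and the gain is \<open>\<eta> / d\<^sup>2\<close>, as in the TDMA rates.\<close>
  have r: "FDMA_rate \<sigma> 1 P1 (gain \<eta> d1 x1 x1) = a" "FDMA_rate \<sigma> 1 P2 (gain \<eta> d2 x2 x2) = b"
    by (simp_all add: FDMA_rate_def gain_def a_def b_def)
  have ab: "0 \<le> a" "0 \<le> b"
    unfolding r[symmetric] using assms by (simp_all add: FDMA_rate_nonneg gain_nonneg)
  \<comment> \<open>Since \<open>u / 0 = 0\<close>, this includes \<open>w = 0\<close>, so the
    endpoints \<rho> = 0 and \<rho> = 1 need no separate argument below.\<close>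
  have div_le: "u / w \<le> c" if "u \<le> w * c" "0 \<le> w" "0 \<le> c" for u w c :: real
    using that by (cases "w = 0") (simp_all add: field_simps)
  have 1: "(R1 / \<rho>, 0) \<in> uplink_FDMA \<eta> \<sigma> d1 d2 x1 x2 P1 P2"
    unfolding uplink_FDMA_def
  proof (intro hull_inc UN_I)
    show "x1 \<in> {x1..x2}" "(1::real) \<in> {0..1}"
      using assms by simp_all
    show "(R1 / \<rho>, 0) \<in> {(R1, R2). 0 \<le> R1 \<and> R1 \<le> FDMA_rate \<sigma> 1 P1 (gain \<eta> d1 x1 x1) \<and>
        0 \<le> R2 \<and> R2 \<le> FDMA_rate \<sigma> (1 - 1) P2 (gain \<eta> d2 x2 x1)}"
      using R \<rho> ab div_le by (simp add: r FDMA_rate_nonneg gain_nonneg assms flip: a_def)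
  qed
  have 2: "(0, R2 / (1 - \<rho>)) \<in> uplink_FDMA \<eta> \<sigma> d1 d2 x1 x2 P1 P2"
    unfolding uplink_FDMA_def
  proof (intro hull_inc UN_I)
    show "x2 \<in> {x1..x2}" "(0::real) \<in> {0..1}"
      using assms by simp_all
    show "(0, R2 / (1 - \<rho>)) \<in> {(R1, R2). 0 \<le> R1 \<and> R1 \<le> FDMA_rate \<sigma> 0 P1 (gain \<eta> d1 x1 x2) \<and>
        0 \<le> R2 \<and> R2 \<le> FDMA_rate \<sigma> (1 - 0) P2 (gain \<eta> d2 x2 x2)}"
      using R \<rho> ab div_le by (simp add: r FDMA_rate_nonneg gain_nonneg assms flip: b_def)
  qed
  have "convex (uplink_FDMA \<eta> \<sigma> d1 d2 x1 x2 P1 P2)"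
    by (simp add: uplink_FDMA_def)
  from convexD[OF this 1 2, of \<rho> "1 - \<rho>"]
  have "(\<rho> * (R1 / \<rho>), (1 - \<rho>) * (R2 / (1 - \<rho>))) \<in> uplink_FDMA \<eta> \<sigma> d1 d2 x1 x2 P1 P2"
    using \<rho> by simp
  \<comment> \<open>If a time share is 0, the bounds in \<open>R\<close> force the corresponding
    rate to be 0, so the cancellation survives division by zero.\<close>
  moreover have "\<rho> * (R1 / \<rho>) = R1" "(1 - \<rho>) * (R2 / (1 - \<rho>)) = R2"
    using R by auto
  ultimately show "(R1, R2) \<in> uplink_FDMA \<eta> \<sigma> d1 d2 x1 x2 P1 P2"
    by simp
qed

theorem mainTheorem7:
  fixes \<eta> \<sigma> d1 d2 P x1 x2 q0 qmax :: real
  assumes "\<eta> > 0" and "\<sigma>\<^sup>2 > 0" and "d1 > 0" and "d2 > 0" and "P > 0"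
    and "x1 \<le> x2" and "{x1..x2} \<subseteq> {q0..qmax}"
  shows "downlink_TDMA \<eta> \<sigma> d1 d2 P \<subseteq> downlink_FDMA \<eta> \<sigma> d1 d2 x1 x2 P \<and>
         downlink_FDMA \<eta> \<sigma> d1 d2 x1 x2 P \<subseteq> downlink_capacity \<eta> \<sigma> d1 d2 x1 x2 q0 qmax P"
  unfolding downlink_TDMA_def downlink_FDMA_def downlink_capacity_def
  using assms
  by (intro conjI downlink_mono uplink_TDMA_subset_FDMA uplink_FDMA_subset_capacity) simp_all

end
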